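(* Let $\mathbb{F}$ be a field and $n\geq 1$. A bilinear form $\theta:\mu_0^n\times\mu_0^n\to\mathbb{F}$ is an assosymmetric cocycle of $\mu_0^n$ if and only if $\theta\in\mathsf{Z}^2_{\mathrm{BC}}(\mu_0^n,\mathbb{F})$.
   Context: $\mu_0^n$ is the $n$-dimensional (associative, commutative) null-filiform algebra over $\mathbb{F}$ with basis $e_1,\dots,e_n$ and product $e_ie_j=e_{i+j}$, where $e_m=0$ for $m>n$. An algebra is assosymmetric if $(xy)z-x(yz)=(yx)z-y(xz)=(xz)y-x(zy)$ for all $x,y,z$. A bilinear form $\theta$ on $\mu_0^n$ is an assosymmetric cocycle if $\theta(xy,z)-\theta(x,yz)=\theta(yx,z)-\theta(y,xz)=\theta(xz,y)-\theta(x,zy)$ for all $x,y,z\in\mu_0^n$. The space $\mathsf{Z}^2_{\mathrm{BC}}(\mu_0^n,\mathbb{F})$ of bicommutative cocycles consists of the bilinear forms $\theta$ on $\mu_0^n$ with $\theta(x,yz)=\theta(y,xz)$ and $\theta(xy,z)=\theta(xz,y)$ for all $x,y,z\in\mu_0^n$. *)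

theory Defs
  imports Complex_Main
begin

text \<open>
  The algebra \<open>\<mu>\<^sub>0\<^sup>n\<close> is realised on coordinate vectors: \<open>x\<close> stands for
  \<open>x 1 e\<^sub>1 + \<dots> + x n e\<^sub>n\<close>, and coordinates outside \<open>{1..n}\<close> vanish. In particular
  \<open>null_filiform_basis n m\<close> is the zero vector for \<open>m > n\<close>.
\<close>

definition null_filiform :: "nat \<Rightarrow> (nat \<Rightarrow> 'a::field) set" where
  "null_filiform n = {x. \<forall>m. m \<notin> {1..n} \<longrightarrow> x m = 0}"

definition null_filiform_basis :: "nat \<Rightarrow> nat \<Rightarrow> (nat \<Rightarrow> 'a::field)" where
  "null_filiform_basis n i = (\<lambda>m. if i \<in> {1..n} \<and> m = i then 1 else 0)"

text \<open>The bilinear extension of \<open>e\<^sub>i e\<^sub>j = e\<^sub>i\<^sub>+\<^sub>j\<close>.\<close>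

definition null_filiform_mult ::
    "nat \<Rightarrow> (nat \<Rightarrow> 'a::field) \<Rightarrow> (nat \<Rightarrow> 'a) \<Rightarrow> (nat \<Rightarrow> 'a)" where
  "null_filiform_mult n x y =
     (\<lambda>m. \<Sum>i=1..n. \<Sum>j=1..n. x i * y j * null_filiform_basis n (i + j) m)"

lemma null_filiform_basis_in: "null_filiform_basis n i \<in> null_filiform n"
  by (auto simp: null_filiform_def null_filiform_basis_def)

lemma null_filiform_basis_eq_0: "m > n \<Longrightarrow> null_filiform_basis n m = (\<lambda>_. 0)"
  by (auto simp: null_filiform_basis_def)

lemma null_filiform_expand:
  assumes "x \<in> null_filiform n"
  shows "x = (\<lambda>m. \<Sum>i=1..n. x i * null_filiform_basis n i m)"
proof
  fix m
  have "(\<Sum>i=1..n. x i * null_filiform_basis n i m) = (\<Sum>i=1..n. if i = m then x i else 0)"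
    by (rule sum.cong) (auto simp: null_filiform_basis_def)
  then show "x m = (\<Sum>i=1..n. x i * null_filiform_basis n i m)"
    using assms by (auto simp: null_filiform_def sum.delta)
qed

lemma null_filiform_mult_in: "null_filiform_mult n x y \<in> null_filiform n"
  by (auto simp: null_filiform_def null_filiform_mult_def null_filiform_basis_def intro!: sum.neutral)

lemma null_filiform_mult_basis:
  assumes "i \<in> {1..n}" "j \<in> {1..n}"
  shows "null_filiform_mult n (null_filiform_basis n i) (null_filiform_basis n j)
       = null_filiform_basis n (i + j)"
proof
  fix m
  let ?b = "null_filiform_basis n :: nat \<Rightarrow> nat \<Rightarrow> 'a"
  have "null_filiform_mult n (?b i) (?b j) m
      = (\<Sum>k=1..n. \<Sum>l=1..n. if l = j then (if k = i then ?b (k + l) m else 0) else 0)"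
    unfolding null_filiform_mult_def
    by (intro sum.cong refl) (use assms in \<open>auto simp: null_filiform_basis_def\<close>)
  also have "\<dots> = ?b (i + j) m"
    using assms by (simp add: sum.delta)
  finally show "null_filiform_mult n (?b i) (?b j) m = ?b (i + j) m" .
qed

text \<open>
  Only the values of \<open>\<theta>\<close> on the algebra matter; nothing is required of its values elsewhere.
\<close>

definition null_filiform_bilinear_form ::
    "nat \<Rightarrow> ((nat \<Rightarrow> 'a::field) \<Rightarrow> (nat \<Rightarrow> 'a) \<Rightarrow> 'a) \<Rightarrow> bool" where
  "null_filiform_bilinear_form n \<theta> \<longleftrightarrow>
     (\<forall>x\<in>null_filiform n. \<forall>y\<in>null_filiform n. \<forall>z\<in>null_filiform n. \<forall>c.
        \<theta> (\<lambda>m. x m + y m) z = \<theta> x z + \<theta> y z \<and>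
        \<theta> (\<lambda>m. c * x m) z = c * \<theta> x z \<and>
        \<theta> z (\<lambda>m. x m + y m) = \<theta> z x + \<theta> z y \<and>
        \<theta> z (\<lambda>m. c * x m) = c * \<theta> z x)"

definition assosymmetric_cocycle ::
    "nat \<Rightarrow> ((nat \<Rightarrow> 'a::field) \<Rightarrow> (nat \<Rightarrow> 'a) \<Rightarrow> 'a) \<Rightarrow> bool" where
  "assosymmetric_cocycle n \<theta> \<longleftrightarrow>
     null_filiform_bilinear_form n \<theta> \<and>
     (\<forall>x\<in>null_filiform n. \<forall>y\<in>null_filiform n. \<forall>z\<in>null_filiform n.
        \<theta> (null_filiform_mult n x y) z - \<theta> x (null_filiform_mult n y z) =
          \<theta> (null_filiform_mult n y x) z - \<theta> y (null_filiform_mult n x z) \<and>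
        \<theta> (null_filiform_mult n y x) z - \<theta> y (null_filiform_mult n x z) =
          \<theta> (null_filiform_mult n x z) y - \<theta> x (null_filiform_mult n z y))"

definition Z2_BC :: "nat \<Rightarrow> ((nat \<Rightarrow> 'a::field) \<Rightarrow> (nat \<Rightarrow> 'a) \<Rightarrow> 'a) set" where
  "Z2_BC n = {\<theta>. null_filiform_bilinear_form n \<theta> \<and>
     (\<forall>x\<in>null_filiform n. \<forall>y\<in>null_filiform n. \<forall>z\<in>null_filiform n.
        \<theta> x (null_filiform_mult n y z) = \<theta> y (null_filiform_mult n x z) \<and>
        \<theta> (null_filiform_mult n x y) z = \<theta> (null_filiform_mult n x z) y)}"

end

theory Submission
  imports Defs
begin

text \<open>
  The equivalence rests only on commutativity of the product. Since \<open>xy = yx\<close>, the terms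
  \<open>\<theta>(xy, z)\<close> and \<open>\<theta>(yx, z)\<close> cancel from the first cocycle identity, which leaves
  \<open>\<theta>(x, yz) = \<theta>(y, xz)\<close>; and \<open>\<theta>(x, yz)\<close> and \<open>\<theta>(x, zy)\<close> cancel when the outer two of the
  three expressions are equated, which leaves \<open>\<theta>(xy, z) = \<theta>(xz, y)\<close>. Both cancellations
  are reversible.
\<close>

lemma null_filiform_mult_commute:
  "null_filiform_mult n x y = null_filiform_mult n y x"
proof
  fix m
  show "null_filiform_mult n x y m = null_filiform_mult n y x m"
    unfolding null_filiform_mult_def
    by (subst sum.swap) (simp add: ac_simps)
qed

theorem mainTheorem4:
  fixes \<theta> :: "(nat \<Rightarrow> 'a::field) \<Rightarrow> (nat \<Rightarrow> 'a) \<Rightarrow> 'a" and n :: nat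
  assumes "n \<ge> 1"
    and "null_filiform_bilinear_form n \<theta>"
  shows "assosymmetric_cocycle n \<theta> \<longleftrightarrow> \<theta> \<in> Z2_BC n"
proof -
  let ?m = "null_filiform_mult n"
  have "(\<theta> (?m x y) z - \<theta> x (?m y z) = \<theta> (?m y x) z - \<theta> y (?m x z) \<and>
         \<theta> (?m y x) z - \<theta> y (?m x z) = \<theta> (?m x z) y - \<theta> x (?m z y)) \<longleftrightarrow>
        (\<theta> x (?m y z) = \<theta> y (?m x z) \<and> \<theta> (?m x y) z = \<theta> (?m x z) y)" for x y z
    unfolding null_filiform_mult_commute[of n y x] null_filiform_mult_commute[of n z y]
    by auto
  then show ?thesis
    using assms(2) by (simp only: assosymmetric_cocycle_def Z2_BC_def mem_Collect_eq)
qed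

end
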